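(* Let $N, K$ be positive integers with $\left\lceil \frac{K+1}{2}\right\rceil \le N \le K$. Then every achievable memory-rate pair $(M,R)$ for the $(N,K)$ cache network satisfies $$K(N-1)M + KR \ge KN-1 .$$
   Context: Notation: $[L]=\{1,\dots,L\}$. $(N,K)$ cache network (with $1\le N\le K$): a server holds $N$ independent files $W_1,\dots,W_N$, each uniformly distributed over $\{0,1\}^F$ for some positive integer $F$; there are $K$ users, and user $k$ has a cache. For $A\subseteq[N]$, $W_A=(W_n)_{n\in A}$. All entropies $H$ are measured in units of $F$ bits, i.e. $H$ is the Shannon entropy in bits divided by $F$, so $H(W_{[N]})=N$. Demands: $\boldsymbol{D}$ is the set of all surjective vectors $\boldsymbol{d}=(d_1,\dots,d_K)\in[N]^K$ (user $k$ requests file $W_{d_k}$, and every file is requested by at least one user). For a permutation $\pi$ of $[K]$, $\pi\boldsymbol{d}$ is the demand in which user $\pi(k)$ requests $W_{d_k}$, i.e. $(\pi\boldsymbol d)_k=d_{\pi^{-1}(k)}$. Caching scheme for $(M,R)$, where $M,R\ge 0$ are real: for some $F$, cache contents $Z_1,\dots,Z_K$, each a function of $(W_1,\dots,W_N)$ taking at most $2^{MF}$ values (so $H(Z_k)\le M$), and for each $\boldsymbol d\in\boldsymbol D$ a broadcast $X_{\boldsymbol d}$, a function of $(W_1,\dots,W_N)$ taking at most $2^{RF}$ values (so $H(X_{\boldsymbol d})\le R$), such that for every $\boldsymbol d\in\boldsymbol D$ and $k\in[K]$ the file $W_{d_k}$ is a function of $(Z_k,X_{\boldsymbol d})$. The cache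 contents do not depend on the demand. For $S\subseteq[K]$, $Z_S=(Z_k)_{k\in S}$. Standing assumption: only symmetric schemes are considered, i.e. schemes with $H(W_A,Z_{\pi(S)},X_{\pi\boldsymbol d})=H(W_A,Z_S,X_{\boldsymbol d})$ for all $A\subseteq[N]$, $S\subseteq[K]$, $\boldsymbol d\in\boldsymbol D$ and all permutations $\pi$ of $[K]$. The pair $(M,R)$ is achievable if there is a (symmetric) caching scheme for $(M,R)$. *)

theory Defs
  imports "HOL-Probability.Probability" "HOL-Combinatorics.Permutations"
begin

definition bit_strings :: "nat \<Rightarrow> bool list set" where
  "bit_strings F = {w. length w = F}"

text \<open>The files are the coordinates \<open>w n\<close>, \<open>n \<in> {1..N}\<close>, of a point \<open>w\<close> of the product
  space: independent, and each uniformly distributed over the bit strings of length \<open>F\<close>.\<close>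

definition file_space :: "nat \<Rightarrow> nat \<Rightarrow> (nat \<Rightarrow> bool list) measure" where
  "file_space N F = (\<Pi>\<^sub>M n\<in>{1..N}. uniform_count_measure (bit_strings F))"

text \<open>Shannon entropy in units of \<open>F\<close> bits of a function of the files.\<close>

definition file_entropy :: "nat \<Rightarrow> nat \<Rightarrow> ((nat \<Rightarrow> bool list) \<Rightarrow> 'b) \<Rightarrow> real" where
  "file_entropy N F Y =
    prob_space.entropy (file_space N F) 2 (count_space (Y ` space (file_space N F))) Y / real F"

definition demands :: "nat \<Rightarrow> nat \<Rightarrow> (nat \<Rightarrow> nat) set" where
  "demands N K = {d \<in> {1..K} \<rightarrow>\<^sub>E {1..N}. d ` {1..K} = {1..N}}"

text \<open>Intended for permutations \<open>\<pi>\<close> of \<open>{1..K}\<close>.\<close>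

definition permute_demand :: "(nat \<Rightarrow> nat) \<Rightarrow> (nat \<Rightarrow> nat) \<Rightarrow> nat \<Rightarrow> nat" where
  "permute_demand \<pi> d = d \<circ> inv \<pi>"

text \<open>\<open>Z k w\<close> is the content of cache \<open>k\<close> and \<open>X d w\<close> the broadcast for the demand \<open>d\<close> when
  the files are \<open>w\<close>. Both take finitely many values, so coding these values by natural numbers
  is no restriction.\<close>

definition caching_scheme ::
  "nat \<Rightarrow> nat \<Rightarrow> real \<Rightarrow> real \<Rightarrow> nat \<Rightarrow> (nat \<Rightarrow> (nat \<Rightarrow> bool list) \<Rightarrow> nat) \<Rightarrow>
    ((nat \<Rightarrow> nat) \<Rightarrow> (nat \<Rightarrow> bool list) \<Rightarrow> nat) \<Rightarrow> bool" where
  "caching_scheme N K M R F Z X \<longleftrightarrow>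
    (\<forall>k\<in>{1..K}. real (card (Z k ` space (file_space N F))) \<le> 2 powr (M * real F)) \<and>
    (\<forall>d\<in>demands N K. real (card (X d ` space (file_space N F))) \<le> 2 powr (R * real F)) \<and>
    (\<forall>d\<in>demands N K. \<forall>k\<in>{1..K}. \<exists>dec. \<forall>w\<in>space (file_space N F).
      w (d k) = dec (Z k w, X d w))"

text \<open>\<open>H(W\<^sub>A, Z\<^sub>S, X\<^sub>d)\<close>\<close>

definition joint_entropy ::
  "nat \<Rightarrow> nat \<Rightarrow> (nat \<Rightarrow> (nat \<Rightarrow> bool list) \<Rightarrow> nat) \<Rightarrow>
    ((nat \<Rightarrow> nat) \<Rightarrow> (nat \<Rightarrow> bool list) \<Rightarrow> nat) \<Rightarrow>
    nat set \<Rightarrow> nat set \<Rightarrow> (nat \<Rightarrow> nat) \<Rightarrow> real" where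
  "joint_entropy N F Z X A S d =
    file_entropy N F (\<lambda>w. (restrict w A, (\<lambda>k\<in>S. Z k w), X d w))"

definition symmetric_scheme ::
  "nat \<Rightarrow> nat \<Rightarrow> nat \<Rightarrow> (nat \<Rightarrow> (nat \<Rightarrow> bool list) \<Rightarrow> nat) \<Rightarrow>
    ((nat \<Rightarrow> nat) \<Rightarrow> (nat \<Rightarrow> bool list) \<Rightarrow> nat) \<Rightarrow> bool" where
  "symmetric_scheme N K F Z X \<longleftrightarrow>
    (\<forall>A\<subseteq>{1..N}. \<forall>S\<subseteq>{1..K}. \<forall>d\<in>demands N K. \<forall>\<pi>. \<pi> permutes {1..K} \<longrightarrow>
      joint_entropy N F Z X A (\<pi> ` S) (permute_demand \<pi> d) = joint_entropy N F Z X A S d)"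

definition achievable :: "nat \<Rightarrow> nat \<Rightarrow> real \<Rightarrow> real \<Rightarrow> bool" where
  "achievable N K M R \<longleftrightarrow> 0 \<le> M \<and> 0 \<le> R \<and>
    (\<exists>F Z X. 0 < F \<and> caching_scheme N K M R F Z X \<and> symmetric_scheme N K F Z X)"


lemma finite_bit_strings: "finite (bit_strings F)"
  and card_bit_strings: "card (bit_strings F) = 2 ^ F"
  using finite_lists_length_eq[of "UNIV :: bool set" F] card_lists_length_eq[of "UNIV :: bool set" F]
  by (simp_all add: bit_strings_def)

lemma bit_strings_nonempty: "bit_strings F \<noteq> {}"
  using card_bit_strings[of F] by force

lemma space_file_space: "space (file_space N F) = {1..N} \<rightarrow>\<^sub>E bit_strings F"
  by (simp add: file_space_def space_PiM space_uniform_count_measure)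

lemma prob_space_file_space: "prob_space (file_space N F)"
  unfolding file_space_def
  by (intro prob_space_PiM prob_space_uniform_count_measure finite_bit_strings bit_strings_nonempty)

lemma permute_demand_in_demands:
  assumes "d \<in> demands N K" "\<pi> permutes {1..K}"
  shows "permute_demand \<pi> d \<in> demands N K"
proof -
  have p: "inv \<pi> permutes {1..K}" using assms(2) by (rule permutes_inv)
  have "(d \<circ> inv \<pi>) ` {1..K} = d ` {1..K}"
    using permutes_image[OF p] by (simp only: image_comp[symmetric])
  moreover have "d \<circ> inv \<pi> \<in> {1..K} \<rightarrow>\<^sub>E {1..N}"
    using assms(1) permutes_in_image[OF p] permutes_not_in[OF p]
    by (auto simp: demands_def PiE_iff extensional_def)
  ultimately show ?thesis
    using assms(1) by (simp add: demands_def permute_demand_def)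
qed

lemma file_space_eq_uniform:
  "file_space N F = uniform_count_measure ({1..N} \<rightarrow>\<^sub>E bit_strings F)"
proof -
  let ?U = "uniform_count_measure (bit_strings F)"
  let ?\<Omega> = "{1..N} \<rightarrow>\<^sub>E bit_strings F"
  interpret U: prob_space ?U
    by (intro prob_space_uniform_count_measure finite_bit_strings bit_strings_nonempty)
  interpret product_prob_space "\<lambda>_. ?U" "{1..N}" ..
  have fin: "finite ?\<Omega>" by (simp add: finite_PiE finite_bit_strings)
  have sub: "A \<in> sets (Pi\<^sub>M {1..N} (\<lambda>_. ?U))" if "A \<subseteq> ?\<Omega>" for A
  proof -
    have "{w} \<in> sets (Pi\<^sub>M {1..N} (\<lambda>_. ?U))" if "w \<in> ?\<Omega>" for w
    proof -
      have "(\<Pi>\<^sub>E n\<in>{1..N}. {w n}) \<in> sets (Pi\<^sub>M {1..N} (\<lambda>_. ?U))"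
        using that by (intro sets_PiM_I_finite) (auto simp: sets_uniform_count_measure PiE_iff)
      moreover have "(\<Pi>\<^sub>E n\<in>{1..N}. {w n}) = {w}"
        using that by (intro PiE_singleton) (auto simp: PiE_iff)
      ultimately show ?thesis by simp
    qed
    then have "(\<Union>w\<in>A. {w}) \<in> sets (Pi\<^sub>M {1..N} (\<lambda>_. ?U))"
      using that finite_subset[OF that fin] by (intro sets.finite_UN) auto
    then show ?thesis by simp
  qed
  have sets_eq: "sets (Pi\<^sub>M {1..N} (\<lambda>_. ?U)) = Pow ?\<Omega>"
    using sub sets.sets_into_space[of _ "Pi\<^sub>M {1..N} (\<lambda>_. ?U)"]
    by (auto simp: space_PiM space_uniform_count_measure)
  have "uniform_count_measure ?\<Omega> = Pi\<^sub>M {1..N} (\<lambda>_. ?U)"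
  proof (rule PiM_eqI)
    show "sets (uniform_count_measure ?\<Omega>) = sets (Pi\<^sub>M {1..N} (\<lambda>_. ?U))"
      unfolding sets_eq sets_uniform_count_measure ..
    fix A assume "\<And>i. i \<in> {1..N} \<Longrightarrow> A i \<in> sets ?U"
    then have A: "\<And>i. i \<in> {1..N} \<Longrightarrow> A i \<subseteq> bit_strings F"
      by (simp add: sets_uniform_count_measure)
    then have "Pi\<^sub>E {1..N} A \<subseteq> ?\<Omega>" by (intro PiE_mono) auto
    then have "emeasure (uniform_count_measure ?\<Omega>) (Pi\<^sub>E {1..N} A)
        = ennreal (real (card (Pi\<^sub>E {1..N} A)) / real (card ?\<Omega>))"
      using fin by (simp add: emeasure_uniform_count_measure)
    also have "\<dots> = ennreal (\<Prod>i\<in>{1..N}. real (card (A i)) / real (card (bit_strings F)))"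
      by (simp add: card_PiE prod_dividef)
    also have "\<dots> = (\<Prod>i\<in>{1..N}. emeasure ?U (A i))"
      using A by (simp add: emeasure_uniform_count_measure finite_bit_strings prod_ennreal[symmetric])
    finally show "emeasure (uniform_count_measure ?\<Omega>) (Pi\<^sub>E {1..N} A)
        = (\<Prod>i\<in>{1..N}. emeasure ?U (A i))" .
  qed simp
  then show ?thesis by (simp add: file_space_def)
qed

lemma file_entropy_all_files:
  assumes "0 < F"
  shows "file_entropy N F (\<lambda>w. restrict w {1..N}) = real N"
proof -
  let ?\<Omega> = "{1..N} \<rightarrow>\<^sub>E bit_strings F"
  let ?Y = "\<lambda>w :: nat \<Rightarrow> bool list. restrict w {1..N}"
  interpret prob_space "file_space N F" by (rule prob_space_file_space)
  interpret information_space "file_space N F" 2 by standard simp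
  have fin: "finite ?\<Omega>" by (simp add: finite_PiE finite_bit_strings)
  have c: "card ?\<Omega> = 2 ^ (N * F)"
    by (simp add: card_PiE card_bit_strings power_mult[symmetric] mult.commute)
  have Y: "?Y w = w" if "w \<in> ?\<Omega>" for w
    using that by (rule PiE_restrict)
  have img: "?Y ` ?\<Omega> = ?\<Omega>"
    using image_cong[OF refl Y] by simp
  have sd: "simple_distributed (file_space N F) ?Y (\<lambda>_. 1 / card ?\<Omega>)"
  proof (rule simple_distributedI)
    show "simple_function (file_space N F) ?Y"
      unfolding file_space_eq_uniform using fin
      by (auto simp: simple_function_def space_uniform_count_measure sets_uniform_count_measure)
    fix x assume "x \<in> ?Y ` space (file_space N F)"
    then have "x \<in> ?\<Omega>" by (simp add: space_file_space img)
    then have "?Y -` {x} \<inter> ?\<Omega> = {x}"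
      using Y by (auto simp del: restrict_apply)
    then show "1 / card ?\<Omega> = measure (file_space N F) (?Y -` {x} \<inter> space (file_space N F))"
      using \<open>x \<in> ?\<Omega>\<close> fin unfolding file_space_eq_uniform
      by (simp add: measure_uniform_count_measure space_uniform_count_measure)
  qed simp
  have "entropy 2 (count_space (?Y ` space (file_space N F))) ?Y
      = - (\<Sum>x\<in>?\<Omega>. 1 / card ?\<Omega> * log 2 (1 / card ?\<Omega>))"
    using entropy_simple_distributed[OF sd] by (simp add: space_file_space img)
  also have "\<dots> = log 2 (2 ^ (N * F))"
    unfolding sum_constant c by (simp add: log_divide)
  also have "\<dots> = real N * real F"
    by (simp add: log_nat_power)
  finally show ?thesis using assms by (simp add: file_entropy_def)
qed

end

theory Submission
  imports Defs
begin

text \<open>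
  Let \<open>A = {1..N - 1}\<close>, \<open>c s = H(W\<^sub>A, Z\<^sub>1, \<dots>, Z\<^sub>s)\<close> and \<open>x s = N + c s - c (s + 1)\<close>. If \<open>d\<close> is a demand
  in which some user outside \<open>U\<close> requests the file \<open>N\<close>, then \<open>x (card U) \<le> H(W\<^sub>A, Z\<^sub>U, X\<^sub>d)\<close>: by symmetry
  \<open>U = {1..s}\<close> and the user is \<open>s + 1\<close>, whose cache completes \<open>(W\<^sub>A, Z\<^sub>U, X\<^sub>d)\<close> to all the files, and
  submodularity applies. If moreover \<open>U\<close> has \<open>N - 1\<close> users who request all of \<open>A\<close>, then
  \<open>H(W\<^sub>A, Z\<^sub>U, X\<^sub>d) = H(Z\<^sub>U, X\<^sub>d) \<le> (N - 1) M + R = C\<close>, so \<open>x s \<le> C\<close> for \<open>s < N\<close> by monotonicity. Two such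
  sets for the same demand, overlapping in \<open>N - 1 - j\<close> users, give
  \<open>x (N - 1 + j) + x (N - 1 - j) \<le> 2 C\<close> for \<open>j \<le> K - N\<close>; here \<open>2 N \<ge> K + 1\<close> ensures \<open>j < N\<close>. Hence the sum of \<open>x s\<close>
  over \<open>s < K\<close> is at most \<open>K C\<close>, while it telescopes to \<open>K N + c 0 - c K \<ge> K N + (N - 1) - N\<close>.
\<close>

section \<open>Entropy as an average over the finite space of files\<close>

lemma simple_function_file_space: "simple_function (file_space N F) Y"
  unfolding file_space_eq_uniform
  by (simp add: simple_function_def space_uniform_count_measure sets_uniform_count_measure
      finite_PiE finite_bit_strings)

lemma information_space_file_space: "information_space (file_space N F) 2"
proof -
  interpret prob_space "file_space N F" by (rule prob_space_file_space)
  show ?thesis by standard simp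
qed

lemma finite_space_file_space: "finite (space (file_space N F))"
  by (simp add: space_file_space finite_PiE finite_bit_strings)

lemma space_file_space_nonempty: "space (file_space N F) \<noteq> {}"
  using prob_space.not_empty[OF prob_space_file_space] .

lemma measure_file_space:
  assumes "E \<subseteq> space (file_space N F)"
  shows "measure (file_space N F) E = card E / card (space (file_space N F))"
  using assms unfolding file_space_eq_uniform
  by (simp add: measure_uniform_count_measure space_uniform_count_measure finite_PiE finite_bit_strings)

text \<open>The probability mass function of \<open>Y\<close>, written as the measure of a fibre so
  that it fits \<open>simple_distributed\<close>.\<close>

definition fiber_prob :: "nat \<Rightarrow> nat \<Rightarrow> ((nat \<Rightarrow> bool list) \<Rightarrow> 'b) \<Rightarrow> 'b \<Rightarrow> real" where
  "fiber_prob N F Y y = measure (file_space N F) (Y -` {y} \<inter> space (file_space N F))"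

lemma fiber_prob_pos:
  assumes "w \<in> space (file_space N F)"
  shows "0 < fiber_prob N F Y (Y w)"
proof -
  have "w \<in> Y -` {Y w} \<inter> space (file_space N F)" using assms by simp
  then have "0 < card (Y -` {Y w} \<inter> space (file_space N F))"
    by (metis card_gt_0_iff empty_iff finite_Int finite_space_file_space)
  moreover have "0 < card (space (file_space N F))"
    by (simp add: card_gt_0_iff finite_space_file_space space_file_space_nonempty)
  ultimately show ?thesis by (simp add: fiber_prob_def measure_file_space)
qed

lemma simple_distributed_fiber_prob:
  "simple_distributed (file_space N F) Y (fiber_prob N F Y)"
proof -
  interpret prob_space "file_space N F" by (rule prob_space_file_space)
  show ?thesis
    by (rule simple_distributedI) (simp_all add: simple_function_file_space fiber_prob_def)
qed

text \<open>Grouping the sample points by their value under \<open>Y\<close>: both sides are the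
  expectation of \<open>g (Y w)\<close>. The right side sums over an index set that does not depend
  on \<open>Y\<close>, so entropies of different variables can be compared point by point.\<close>

lemma sum_fiber_prob:
  "(\<Sum>y\<in>Y ` space (file_space N F). fiber_prob N F Y y * g y)
    = (\<Sum>w\<in>space (file_space N F). g (Y w)) / card (space (file_space N F))"
proof -
  let ?\<Omega> = "space (file_space N F)"
  have "(\<Sum>w\<in>?\<Omega>. g (Y w)) = (\<Sum>y\<in>Y ` ?\<Omega>. \<Sum>w\<in>{w\<in>?\<Omega>. Y w = y}. g (Y w))"
    by (rule sum.image_gen[OF finite_space_file_space])
  also have "\<dots> = (\<Sum>y\<in>Y ` ?\<Omega>. real (card (Y -` {y} \<inter> ?\<Omega>)) * g y)"
  proof (rule sum.cong[OF refl])
    fix y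
    have "{w\<in>?\<Omega>. Y w = y} = Y -` {y} \<inter> ?\<Omega>" by auto
    then show "(\<Sum>w\<in>{w\<in>?\<Omega>. Y w = y}. g (Y w)) = real (card (Y -` {y} \<inter> ?\<Omega>)) * g y"
      by simp
  qed
  finally show ?thesis
    by (simp add: fiber_prob_def measure_file_space sum_divide_distrib)
qed

lemma file_entropy_eq_sum:
  "file_entropy N F Y = - (\<Sum>w\<in>space (file_space N F). log 2 (fiber_prob N F Y (Y w)))
    / card (space (file_space N F)) / real F"
proof -
  interpret information_space "file_space N F" 2 by (rule information_space_file_space)
  show ?thesis
    unfolding file_entropy_def entropy_simple_distributed[OF simple_distributed_fiber_prob]
      sum_fiber_prob by simp
qed

section \<open>Shannon inequalities\<close>

text \<open>The difference of the two sides is, up to division by \<open>F\<close>, the conditional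
  mutual information of \<open>X\<close> and \<open>Y\<close> given \<open>T\<close>, which is
  nonnegative. Averaged over the sample space, the logarithm of its density splits into the four
  entropies.\<close>

lemma file_entropy_submodular:
  "file_entropy N F (\<lambda>w. (X w, Y w, T w)) + file_entropy N F T
    \<le> file_entropy N F (\<lambda>w. (X w, T w)) + file_entropy N F (\<lambda>w. (Y w, T w))"
proof -
  interpret information_space "file_space N F" 2 by (rule information_space_file_space)
  let ?\<Omega> = "space (file_space N F)"
  let ?p = "fiber_prob N F T" and ?px = "fiber_prob N F (\<lambda>w. (X w, T w))"
  let ?py = "fiber_prob N F (\<lambda>w. (Y w, T w))" and ?pxy = "fiber_prob N F (\<lambda>w. (X w, Y w, T w))"
  have "0 \<le> conditional_mutual_information 2 (count_space (X ` ?\<Omega>)) (count_space (Y ` ?\<Omega>))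
      (count_space (T ` ?\<Omega>)) X Y T"
    by (intro conditional_mutual_information_nonneg simple_function_file_space)
  also have "\<dots> = (\<Sum>v\<in>(\<lambda>w. (X w, Y w, T w)) ` ?\<Omega>. ?pxy v * (\<lambda>(x, y, t).
      log 2 (?pxy (x, y, t) / (?px (x, t) * (?py (y, t) / ?p t)))) v)"
    by (subst conditional_mutual_information_eq) (auto intro!: simple_distributed_fiber_prob sum.cong)
  also have "\<dots> = (\<Sum>w\<in>?\<Omega>. log 2 (?pxy (X w, Y w, T w) /
      (?px (X w, T w) * (?py (Y w, T w) / ?p (T w))))) / card ?\<Omega>"
    unfolding sum_fiber_prob by simp
  also have "\<dots> = (\<Sum>w\<in>?\<Omega>. log 2 (?pxy (X w, Y w, T w)) + log 2 (?p (T w))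
      - log 2 (?px (X w, T w)) - log 2 (?py (Y w, T w))) / card ?\<Omega>"
  proof (intro arg_cong2[where f = divide] sum.cong refl)
    fix w assume w: "w \<in> ?\<Omega>"
    show "log 2 (?pxy (X w, Y w, T w) / (?px (X w, T w) * (?py (Y w, T w) / ?p (T w)))) =
        log 2 (?pxy (X w, Y w, T w)) + log 2 (?p (T w))
        - log 2 (?px (X w, T w)) - log 2 (?py (Y w, T w))"
      using fiber_prob_pos[OF w, of T] fiber_prob_pos[OF w, of "\<lambda>w. (X w, T w)"]
        fiber_prob_pos[OF w, of "\<lambda>w. (Y w, T w)"] fiber_prob_pos[OF w, of "\<lambda>w. (X w, Y w, T w)"]
      by (simp add: log_divide log_mult)
  qed
  finally have "0 \<le> (\<Sum>w\<in>?\<Omega>. log 2 (?pxy (X w, Y w, T w)) + log 2 (?p (T w))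
      - log 2 (?px (X w, T w)) - log 2 (?py (Y w, T w))) / card ?\<Omega> / real F"
    by (rule divide_nonneg_nonneg) simp
  then show ?thesis
    unfolding file_entropy_eq_sum
    by (simp add: sum.distrib sum_subtractf diff_divide_distrib add_divide_distrib)
qed

text \<open>The assumption says that \<open>Y\<close> is a function of \<open>Y'\<close> on the
  sample space, so each fibre of \<open>Y'\<close> lies in a fibre of \<open>Y\<close>. Below, this
  also serves to regroup the components of a tuple.\<close>

lemma file_entropy_mono:
  assumes "\<And>w w'. w \<in> space (file_space N F) \<Longrightarrow> w' \<in> space (file_space N F) \<Longrightarrow>
      Y' w = Y' w' \<Longrightarrow> Y w = Y w'"
  shows "file_entropy N F Y \<le> file_entropy N F Y'"
proof -
  have "log 2 (fiber_prob N F Y' (Y' w)) \<le> log 2 (fiber_prob N F Y (Y w))"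
    if w: "w \<in> space (file_space N F)" for w
  proof -
    interpret prob_space "file_space N F" by (rule prob_space_file_space)
    have "Y' -` {Y' w} \<inter> space (file_space N F) \<subseteq> Y -` {Y w} \<inter> space (file_space N F)"
      using w by (auto intro: assms)
    then have "fiber_prob N F Y' (Y' w) \<le> fiber_prob N F Y (Y w)"
      unfolding fiber_prob_def
      by (rule finite_measure_mono)
        (rule simple_functionD(2)[OF simple_function_file_space])
    then show ?thesis using fiber_prob_pos[OF w, of Y] fiber_prob_pos[OF w, of Y'] by simp
  qed
  then show ?thesis
    unfolding file_entropy_eq_sum by (intro divide_right_mono) (auto intro: sum_mono)
qed

lemma file_entropy_le_card:
  assumes "0 < F" and "real (card (Y ` space (file_space N F))) \<le> 2 powr (c * real F)"
  shows "file_entropy N F Y \<le> c"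
proof -
  interpret information_space "file_space N F" 2 by (rule information_space_file_space)
  let ?V = "Y ` space (file_space N F)"
  have "0 < card ?V"
    by (simp add: card_gt_0_iff finite_space_file_space space_file_space_nonempty)
  then have "log 2 (card ?V) \<le> c * real F"
    using assms(2) by (simp add: log_le_iff)
  then have "entropy 2 (count_space ?V) Y \<le> c * real F"
    using entropy_le_card[OF simple_distributed_fiber_prob, of Y] by linarith
  then show ?thesis using assms(1) by (simp add: file_entropy_def pos_divide_le_eq)
qed

text \<open>All \<open>N\<close> files have entropy \<open>N\<close>, and by subadditivity file
  \<open>N\<close> accounts for at most 1 of it.\<close>

lemma file_entropy_restrict_ge:
  assumes "0 < F" "0 < N"
  shows "real N - 1 \<le> file_entropy N F (\<lambda>w. restrict w {1..N - 1})"
proof -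
  \<comment> \<open>The constant \<open>?T\<close> turns submodularity into plain
    subadditivity.\<close>
  let ?\<Omega> = "space (file_space N F)" and ?T = "\<lambda>w :: nat \<Rightarrow> bool list. ()"
  have "real (card ((\<lambda>w. (w N, ?T w)) ` ?\<Omega>)) \<le> real (card (bit_strings F \<times> {()}))"
    using assms(2)
    by (intro of_nat_mono card_mono) (auto simp: finite_bit_strings space_file_space PiE_iff)
  then have N: "file_entropy N F (\<lambda>w. (w N, ?T w)) \<le> 1"
    using assms(1) by (intro file_entropy_le_card) (simp_all add: card_cartesian_product card_bit_strings powr_realpow)
  have "real N = file_entropy N F (\<lambda>w. restrict w {1..N})"
    using assms by (simp only: file_entropy_all_files)
  also have "\<dots> \<le> file_entropy N F (\<lambda>w. (restrict w {1..N - 1}, w N, ?T w))"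
  proof (rule file_entropy_mono)
    fix w w' :: "nat \<Rightarrow> bool list"
    assume "(restrict w {1..N - 1}, w N, ?T w) = (restrict w' {1..N - 1}, w' N, ?T w')"
    then have N: "w N = w' N" and *: "restrict w {1..N - 1} = restrict w' {1..N - 1}"
      by auto
    show "restrict w {1..N} = restrict w' {1..N}"
    proof (rule restrict_ext)
      fix i assume i: "i \<in> {1..N}"
      show "w i = w' i"
      proof (cases "i = N")
        case False
        then have "i \<in> {1..N - 1}" using i by auto
        then show ?thesis using fun_cong[OF *, of i] by simp
      qed (use N in simp)
    qed
  qed
  also have "\<dots> \<le> file_entropy N F (\<lambda>w. (restrict w {1..N - 1}, ?T w))
      + file_entropy N F (\<lambda>w. (w N, ?T w)) - file_entropy N F ?T"
    using file_entropy_submodular[of N F "\<lambda>w. restrict w {1..N - 1}" "\<lambda>w. w N" ?T] by linarith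
  also have "file_entropy N F ?T = 0"
    using prob_space.prob_space[OF prob_space_file_space]
    by (simp add: file_entropy_eq_sum fiber_prob_def vimage_def)
  also have "file_entropy N F (\<lambda>w. (restrict w {1..N - 1}, ?T w))
      \<le> file_entropy N F (\<lambda>w. restrict w {1..N - 1})"
    by (rule file_entropy_mono) simp
  finally show ?thesis using N by linarith
qed

section \<open>Entropies of files, caches and broadcasts\<close>

definition cache_entropy ::
  "nat \<Rightarrow> nat \<Rightarrow> (nat \<Rightarrow> (nat \<Rightarrow> bool list) \<Rightarrow> nat) \<Rightarrow> nat set \<Rightarrow> nat set \<Rightarrow> real" where
  "cache_entropy N F Z A S = file_entropy N F (\<lambda>w. (restrict w A, (\<lambda>k\<in>S. Z k w)))"

text \<open>Turns equality of bundled files or caches into agreement at each index, the form in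
  which functional dependence is checked.\<close>

lemma restrict_eq_iff: "restrict f S = restrict g S \<longleftrightarrow> (\<forall>x\<in>S. f x = g x)"
  by (auto simp: restrict_def fun_eq_iff)

lemma joint_entropy_mono:
  assumes "S \<subseteq> S'"
  shows "joint_entropy N F Z X A S d \<le> joint_entropy N F Z X A S' d"
  unfolding joint_entropy_def
  by (rule file_entropy_mono) (use assms in \<open>auto simp: restrict_eq_iff\<close>)

lemma cache_entropy_le:
  assumes "0 < F"
  shows "cache_entropy N F Z A S \<le> real N"
proof -
  have "cache_entropy N F Z A S \<le> file_entropy N F (\<lambda>w. restrict w {1..N})"
    unfolding cache_entropy_def
  proof (rule file_entropy_mono)
    fix w w'
    assume "w \<in> space (file_space N F)" "w' \<in> space (file_space N F)"
      "restrict w {1..N} = restrict w' {1..N}"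
    then have "w = w'" by (simp add: space_file_space PiE_restrict)
    then show "(restrict w A, \<lambda>k\<in>S. Z k w) = (restrict w' A, \<lambda>k\<in>S. Z k w')" by simp
  qed
  then show ?thesis using assms by (simp only: file_entropy_all_files)
qed

lemma joint_entropy_submodular:
  "joint_entropy N F Z X A (S \<union> T) d + joint_entropy N F Z X A (S \<inter> T) d
    \<le> joint_entropy N F Z X A S d + joint_entropy N F Z X A T d"
proof -
  \<comment> \<open>\<open>?J\<close> collects what the two families share: joined with the caches
    of \<open>S\<close>, of \<open>T\<close> or of both it yields three of the entropies, and by
    itself it gives the fourth.\<close>
  let ?J = "\<lambda>w. (restrict w A, \<lambda>k\<in>S \<inter> T. Z k w, X d w)"
  have "joint_entropy N F Z X A (S \<union> T) d
      \<le> file_entropy N F (\<lambda>w. (\<lambda>k\<in>S. Z k w, \<lambda>k\<in>T. Z k w, ?J w))"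
    unfolding joint_entropy_def by (rule file_entropy_mono) (auto simp: restrict_eq_iff)
  moreover have "file_entropy N F (\<lambda>w. (\<lambda>k\<in>S. Z k w, ?J w)) \<le> joint_entropy N F Z X A S d"
    "file_entropy N F (\<lambda>w. (\<lambda>k\<in>T. Z k w, ?J w)) \<le> joint_entropy N F Z X A T d"
    unfolding joint_entropy_def by (rule file_entropy_mono; auto simp: restrict_eq_iff)+
  moreover have "joint_entropy N F Z X A (S \<inter> T) d = file_entropy N F ?J"
    by (simp add: joint_entropy_def)
  ultimately show ?thesis
    using file_entropy_submodular[of N F "\<lambda>w. \<lambda>k\<in>S. Z k w" "\<lambda>w. \<lambda>k\<in>T. Z k w" ?J] by linarith
qed

text \<open>Knowing more caches cannot increase the conditional entropy of the broadcast: this is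
  submodularity for the caches of \<open>T\<close> and \<open>X d\<close>, given the files of
  \<open>A\<close> and the caches of \<open>S\<close>.\<close>

lemma cache_joint_entropy_submodular:
  assumes "S \<subseteq> T"
  shows "joint_entropy N F Z X A T d + cache_entropy N F Z A S
    \<le> cache_entropy N F Z A T + joint_entropy N F Z X A S d"
proof -
  let ?J = "\<lambda>w. (restrict w A, \<lambda>k\<in>S. Z k w)"
  have "joint_entropy N F Z X A T d \<le> file_entropy N F (\<lambda>w. (\<lambda>k\<in>T. Z k w, X d w, ?J w))"
    unfolding joint_entropy_def by (rule file_entropy_mono) (auto simp: restrict_eq_iff)
  moreover have "file_entropy N F (\<lambda>w. (\<lambda>k\<in>T. Z k w, ?J w)) \<le> cache_entropy N F Z A T"
    unfolding cache_entropy_def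
    by (rule file_entropy_mono) (use assms in \<open>auto simp: restrict_eq_iff\<close>)
  moreover have "file_entropy N F (\<lambda>w. (X d w, ?J w)) \<le> joint_entropy N F Z X A S d"
    unfolding joint_entropy_def by (rule file_entropy_mono) auto
  ultimately show ?thesis
    using file_entropy_submodular[of N F "\<lambda>w. \<lambda>k\<in>T. Z k w" "X d" ?J]
    unfolding cache_entropy_def by linarith
qed

lemma caching_scheme_decode:
  assumes "caching_scheme N K M R F Z X" "d \<in> demands N K" "k \<in> {1..K}"
    and "w \<in> space (file_space N F)" "w' \<in> space (file_space N F)"
    and "Z k w = Z k w'" "X d w = X d w'"
  shows "w (d k) = w' (d k)"
  using assms unfolding caching_scheme_def by metis

text \<open>The users in \<open>S\<close> decode their requested files, so together with the files
  of \<open>A\<close> the tuple determines all \<open>N\<close> files.\<close>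

lemma joint_entropy_ge_all:
  assumes "0 < F" "caching_scheme N K M R F Z X" "d \<in> demands N K" "S \<subseteq> {1..K}"
    and "{1..N} \<subseteq> A \<union> d ` S"
  shows "real N \<le> joint_entropy N F Z X A S d"
proof -
  have "file_entropy N F (\<lambda>w. restrict w {1..N}) \<le> joint_entropy N F Z X A S d"
    unfolding joint_entropy_def
  proof (rule file_entropy_mono)
    fix w w'
    assume w: "w \<in> space (file_space N F)" "w' \<in> space (file_space N F)"
      and "(restrict w A, \<lambda>k\<in>S. Z k w, X d w) = (restrict w' A, \<lambda>k\<in>S. Z k w', X d w')"
    then have eq: "\<forall>n\<in>A. w n = w' n" "\<forall>k\<in>S. Z k w = Z k w'" "X d w = X d w'"
      by (simp_all add: restrict_eq_iff)
    have "w (d k) = w' (d k)" if "k \<in> S" for k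
      using caching_scheme_decode[OF assms(2,3) _ w] that eq assms(4) by blast
    then have "\<forall>n\<in>A \<union> d ` S. w n = w' n" using eq(1) by auto
    then show "restrict w {1..N} = restrict w' {1..N}"
      using assms(5) by (auto simp: restrict_eq_iff)
  qed
  then show ?thesis using assms(1) by (simp only: file_entropy_all_files)
qed

text \<open>The users in \<open>S\<close> decode the files of \<open>A\<close>, which are thus
  redundant. The remaining tuple of \<open>card S\<close> caches and one broadcast is bounded by
  counting its values.\<close>

lemma joint_entropy_le_rate:
  assumes "0 < F" "caching_scheme N K M R F Z X" "d \<in> demands N K" "S \<subseteq> {1..K}"
    and "A \<subseteq> d ` S"
  shows "joint_entropy N F Z X A S d \<le> real (card S) * M + R"
proof -
  let ?\<Omega> = "space (file_space N F)" and ?Y = "\<lambda>w. (\<lambda>k\<in>S. Z k w, X d w)"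
  have fin: "finite S" using assms(4) finite_subset by blast
  have "joint_entropy N F Z X A S d \<le> file_entropy N F ?Y"
    unfolding joint_entropy_def
  proof (rule file_entropy_mono)
    fix w w'
    assume w: "w \<in> ?\<Omega>" "w' \<in> ?\<Omega>" and "?Y w = ?Y w'"
    then have eq: "\<forall>k\<in>S. Z k w = Z k w'" "X d w = X d w'"
      by (simp_all add: restrict_eq_iff)
    have "w (d k) = w' (d k)" if "k \<in> S" for k
      using caching_scheme_decode[OF assms(2,3) _ w] that eq assms(4) by blast
    then show "(restrict w A, \<lambda>k\<in>S. Z k w, X d w) = (restrict w' A, \<lambda>k\<in>S. Z k w', X d w')"
      using assms(5) eq by (auto simp: restrict_eq_iff)
  qed
  also have "\<dots> \<le> real (card S) * M + R"
  proof (rule file_entropy_le_card[OF assms(1)])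
    have "?Y ` ?\<Omega> \<subseteq> (\<Pi>\<^sub>E k\<in>S. Z k ` ?\<Omega>) \<times> X d ` ?\<Omega>" by auto
    then have "card (?Y ` ?\<Omega>) \<le> card ((\<Pi>\<^sub>E k\<in>S. Z k ` ?\<Omega>) \<times> X d ` ?\<Omega>)"
      by (intro card_mono finite_cartesian_product finite_PiE fin finite_imageI
          finite_space_file_space)
    also have "\<dots> = (\<Prod>k\<in>S. card (Z k ` ?\<Omega>)) * card (X d ` ?\<Omega>)"
      by (simp add: card_cartesian_product card_PiE fin)
    finally have "real (card (?Y ` ?\<Omega>)) \<le> (\<Prod>k\<in>S. real (card (Z k ` ?\<Omega>))) * real (card (X d ` ?\<Omega>))"
      by (simp only: of_nat_prod[symmetric] of_nat_mult[symmetric] of_nat_le_iff)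
    also have "\<dots> \<le> (\<Prod>k\<in>S. 2 powr (M * real F)) * 2 powr (R * real F)"
      using assms(2,3,4) unfolding caching_scheme_def
      by (intro mult_mono prod_mono) (auto intro: prod_nonneg)
    also have "\<dots> = 2 powr ((real (card S) * M + R) * real F)"
      by (simp add: powr_power powr_add[symmetric] algebra_simps)
    finally show "real (card (?Y ` ?\<Omega>)) \<le> 2 powr ((real (card S) * M + R) * real F)" .
  qed
  finally show ?thesis .
qed

section \<open>Symmetry and bounds on the increments of cache entropy\<close>

text \<open>Symmetry is stated for permutations of all users, so bijections on \<open>U\<close>, on
  \<open>{q}\<close> and on the remaining users are glued, with images below, at and above
  \<open>Suc s\<close>.\<close>

lemma obtain_permutation_onto_initial_segment:
  fixes K s q :: nat
  assumes "U \<subseteq> {1..K}" "card U = s" "q \<in> {1..K}" "q \<notin> U"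
  obtains \<pi> where "\<pi> permutes {1..K}" "\<pi> ` U = {1..s}" "\<pi> q = Suc s"
proof -
  have finU: "finite U" using assms(1) finite_subset by blast
  have "card (insert q U) = Suc s" using assms finU by simp
  moreover have sub: "insert q U \<subseteq> {1..K}" using assms by simp
  ultimately have s: "Suc s \<le> K" using card_mono[of "{1..K}" "insert q U"] by simp
  obtain f where f: "bij_betw f U {1..s}"
    using assms(2) finU by (metis card_atLeastAtMost diff_Suc_1 finite_atLeastAtMost finite_same_card_bij)
  have "card ({1..K} - insert q U) = card {Suc (Suc s)..K}"
    using sub finU \<open>card (insert q U) = Suc s\<close> by (subst card_Diff_subset) auto
  then obtain g where g: "bij_betw g ({1..K} - insert q U) {Suc (Suc s)..K}"
    by (metis finite_Diff finite_atLeastAtMost finite_same_card_bij)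
  define \<pi> where "\<pi> k = (if k \<in> U then f k else if k = q then Suc s
      else if k \<in> {1..K} then g k else k)" for k
  have "bij_betw \<pi> U {1..s}"
    using f by (rule bij_betw_cong[THEN iffD1, rotated]) (simp add: \<pi>_def)
  moreover have "bij_betw \<pi> {q} {Suc s}"
    using assms(4) by (simp add: \<pi>_def bij_betw_def)
  moreover have "bij_betw \<pi> ({1..K} - insert q U) {Suc (Suc s)..K}"
    using g by (rule bij_betw_cong[THEN iffD1, rotated]) (simp add: \<pi>_def)
  ultimately have "bij_betw \<pi> ((U \<union> {q}) \<union> ({1..K} - insert q U))
      (({1..s} \<union> {Suc s}) \<union> {Suc (Suc s)..K})"
    by (intro bij_betw_combine) auto
  moreover have "(U \<union> {q}) \<union> ({1..K} - insert q U) = {1..K}" using sub by auto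
  moreover have "({1..s} \<union> {Suc s}) \<union> {Suc (Suc s)..K} = {1..K}" using s by auto
  ultimately have "bij_betw \<pi> {1..K} {1..K}" by simp
  then have "\<pi> permutes {1..K}"
    by (rule bij_imp_permutes) (use sub in \<open>auto simp: \<pi>_def\<close>)
  moreover have "\<pi> ` U = {1..s}"
    using \<open>bij_betw \<pi> U {1..s}\<close> by (rule bij_betw_imp_surj_on)
  moreover have "\<pi> q = Suc s" using assms(4) by (simp add: \<pi>_def)
  ultimately show thesis by (rule that)
qed

text \<open>\<open>A\<close> misses only the file that user \<open>q\<close> decodes. The
  relabelling acts on an entropy that includes the broadcast, as symmetry requires; the cache
  entropies occur only for initial segments.\<close>

lemma cache_increment_le_joint_entropy:
  assumes "0 < F" "caching_scheme N K M R F Z X" "symmetric_scheme N K F Z X"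
    and "d \<in> demands N K" "U \<subseteq> {1..K}" "q \<in> {1..K}" "q \<notin> U" "A = {1..N} - {d q}"
  shows "real N + cache_entropy N F Z A {1..card U} - cache_entropy N F Z A {1..Suc (card U)}
    \<le> joint_entropy N F Z X A U d"
proof -
  obtain \<pi> where p: "\<pi> permutes {1..K}" "\<pi> ` U = {1..card U}" "\<pi> q = Suc (card U)"
    using obtain_permutation_onto_initial_segment[OF assms(5) refl assms(6,7)] .
  let ?d = "permute_demand \<pi> d"
  have d: "?d \<in> demands N K" using assms(4) p(1) by (rule permute_demand_in_demands)
  have "?d (Suc (card U)) = d q"
    using p permutes_inverses(2)[OF p(1)] by (metis comp_apply permute_demand_def)
  then have all: "{1..N} \<subseteq> A \<union> ?d ` {1..Suc (card U)}" using assms(8) by force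
  have "Suc (card U) \<le> K"
    using permutes_in_image[OF p(1), of q] assms(6) p(3) by auto
  then have "real N \<le> joint_entropy N F Z X A {1..Suc (card U)} ?d"
    by (intro joint_entropy_ge_all[OF assms(1,2) d _ all]) auto
  moreover have "joint_entropy N F Z X A {1..Suc (card U)} ?d + cache_entropy N F Z A {1..card U}
      \<le> cache_entropy N F Z A {1..Suc (card U)} + joint_entropy N F Z X A {1..card U} ?d"
    by (rule cache_joint_entropy_submodular) auto
  moreover have "joint_entropy N F Z X A {1..card U} ?d = joint_entropy N F Z X A U d"
    using assms(3,4,5,8) p(1,2) unfolding symmetric_scheme_def by (metis Diff_subset)
  ultimately show ?thesis by linarith
qed

text \<open>Both \<open>{1..N - 1}\<close> and its shift \<open>{j + 1..N - 1 + j}\<close> request every file below \<open>N\<close>, since the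
  users \<open>1, \<dots>, j\<close> and \<open>N, \<dots>, N - 1 + j\<close> have the same requests.\<close>

definition shifted_demand :: "nat \<Rightarrow> nat \<Rightarrow> nat \<Rightarrow> nat \<Rightarrow> nat" where
  "shifted_demand N K j = (\<lambda>k\<in>{1..K}.
    if k < N then k else if k < N + j then Suc k - N else N)"

text \<open>User \<open>K\<close> lies past the repeated block because \<open>N + j \<le> K\<close>,
  hence requests \<open>N\<close>; each user below \<open>N\<close> requests the file of the same
  number. Since \<open>j < N\<close>, the repeated requests stay in range.\<close>

lemma shifted_demand_in_demands:
  assumes "0 < N" "N + j \<le> K" "j < N"
  shows "shifted_demand N K j \<in> demands N K"
proof -
  have "n \<in> shifted_demand N K j ` {1..K}" if "n \<in> {1..N}" for n
  proof (cases "n = N")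
    case True
    then have "n = shifted_demand N K j K" using assms by (simp add: shifted_demand_def)
    then show ?thesis using assms by (auto intro!: image_eqI[of _ _ K])
  next
    case False
    then have "n = shifted_demand N K j n" using that assms by (simp add: shifted_demand_def)
    then show ?thesis using that assms by (auto intro!: image_eqI[of _ _ n])
  qed
  moreover have "shifted_demand N K j \<in> {1..K} \<rightarrow>\<^sub>E {1..N}"
    using assms by (auto simp: shifted_demand_def)
  ultimately show ?thesis by (auto simp: demands_def)
qed

lemma shifted_demand_joint_entropy_le_rate:
  assumes "0 < F" "caching_scheme N K M R F Z X" "0 < N" "N + j \<le> K" "j < N"
  shows "joint_entropy N F Z X {1..N - 1} {1..N - 1} (shifted_demand N K j) \<le> (real N - 1) * M + R"
proof -
  let ?d = "shifted_demand N K j" and ?A = "{1..N - 1}"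
  have d: "?d \<in> demands N K" using assms by (intro shifted_demand_in_demands) auto
  have "joint_entropy N F Z X ?A ?A ?d \<le> real (card ?A) * M + R"
  proof (rule joint_entropy_le_rate[OF assms(1,2) d])
    have "n = ?d n" if "n \<in> ?A" for n using that assms by (auto simp: shifted_demand_def)
    then show "?A \<subseteq> ?d ` ?A" by blast
  qed (use assms in auto)
  moreover have "real (card ?A) = real N - 1" using assms by simp
  ultimately show ?thesis by simp
qed

lemma cache_increment_le_rate:
  assumes "0 < F" "caching_scheme N K M R F Z X" "symmetric_scheme N K F Z X"
    and "0 < N" "N \<le> K" "s < N"
  shows "real N + cache_entropy N F Z {1..N - 1} {1..s} - cache_entropy N F Z {1..N - 1} {1..Suc s}
    \<le> (real N - 1) * M + R"
proof -
  \<comment> \<open>With shift 0, users \<open>1\<close> to \<open>N - 1\<close> request all of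
    \<open>?A\<close>, and user \<open>N\<close>, outside \<open>{1..s}\<close> as
    \<open>s < N\<close>, requests file \<open>N\<close>.\<close>
  let ?d = "shifted_demand N K 0" and ?A = "{1..N - 1}"
  have d: "?d \<in> demands N K" using assms by (intro shifted_demand_in_demands) auto
  have dN: "?d N = N" using assms by (simp add: shifted_demand_def)
  have "real N + cache_entropy N F Z ?A {1..card {1..s}} - cache_entropy N F Z ?A {1..Suc (card {1..s})}
      \<le> joint_entropy N F Z X ?A {1..s} ?d"
    by (rule cache_increment_le_joint_entropy[OF assms(1-3) d, where q = N])
      (use assms dN in auto)
  also have "\<dots> \<le> joint_entropy N F Z X ?A ?A ?d"
    using assms by (intro joint_entropy_mono) auto
  also have "\<dots> \<le> (real N - 1) * M + R"
    using assms by (intro shifted_demand_joint_entropy_le_rate) auto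
  finally show ?thesis by simp
qed

text \<open>The windows \<open>{1..N - 1}\<close> and \<open>{Suc j..N - 1 + j}\<close> each decode
  the files below \<open>N\<close>, so each has joint entropy at most
  \<open>(real N - 1) * M + R\<close>. Submodularity passes this to their union and intersection,
  whose sizes are the two indices of \<open>x\<close>.\<close>

lemma cache_increment_pair_le_rate:
  assumes "0 < F" "caching_scheme N K M R F Z X" "symmetric_scheme N K F Z X"
    and "0 < N" "N + j \<le> K" "j < N"
    and x: "\<And>s. x s = real N + cache_entropy N F Z {1..N - 1} {1..s}
      - cache_entropy N F Z {1..N - 1} {1..Suc s}"
  shows "x (N - 1 + j) + x (N - 1 - j) \<le> 2 * ((real N - 1) * M + R)"
proof -
  let ?d = "shifted_demand N K j" and ?A = "{1..N - 1}" and ?T = "{Suc j..N - 1 + j}"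
  have d: "?d \<in> demands N K" using assms by (intro shifted_demand_in_demands) auto
  \<comment> \<open>User \<open>N + j\<close> is the first to request file \<open>N\<close> and lies
    just beyond both windows, so it serves as \<open>q\<close> for the union and for the
    intersection.\<close>
  have dq: "?d (N + j) = N" using assms by (simp add: shifted_demand_def)
  have A: "?A = {1..N} - {?d (N + j)}" unfolding dq using assms by auto
  have union: "x (card (?A \<union> ?T)) \<le> joint_entropy N F Z X ?A (?A \<union> ?T) ?d"
    unfolding x by (rule cache_increment_le_joint_entropy[OF assms(1-3) d _ _ _ A])
      (use assms in auto)
  have inter: "x (card (?A \<inter> ?T)) \<le> joint_entropy N F Z X ?A (?A \<inter> ?T) ?d"
    unfolding x by (rule cache_increment_le_joint_entropy[OF assms(1-3) d _ _ _ A])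
      (use assms in auto)
  have "?A \<union> ?T = {1..N - 1 + j}" "?A \<inter> ?T = {Suc j..N - 1}"
    using assms by auto
  then have cards: "card (?A \<union> ?T) = N - 1 + j" "card (?A \<inter> ?T) = N - 1 - j" by simp_all
  have submod: "joint_entropy N F Z X ?A (?A \<union> ?T) ?d + joint_entropy N F Z X ?A (?A \<inter> ?T) ?d
      \<le> joint_entropy N F Z X ?A ?A ?d + joint_entropy N F Z X ?A ?T ?d"
    by (rule joint_entropy_submodular)
  have rateA: "joint_entropy N F Z X ?A ?A ?d \<le> (real N - 1) * M + R"
    using assms(1-6) by (intro shifted_demand_joint_entropy_le_rate)
  have rateT: "joint_entropy N F Z X ?A ?T ?d \<le> real (card ?T) * M + R"
  proof (rule joint_entropy_le_rate[OF assms(1,2) d])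
    show "?A \<subseteq> ?d ` ?T"
    proof
      fix n assume n: "n \<in> ?A"
      show "n \<in> ?d ` ?T"
      proof (cases "n \<le> j")
        case True
        \<comment> \<open>User \<open>N - 1 + n\<close> repeats the request of user
          \<open>n\<close>, whom the shift drops.\<close>
        then have "n = ?d (N - 1 + n)" "N - 1 + n \<in> ?T"
          using n assms by (auto simp: shifted_demand_def)
        then show ?thesis by (rule image_eqI)
      next
        case False
        then have "n = ?d n" "n \<in> ?T" using n assms by (auto simp: shifted_demand_def)
        then show ?thesis by (rule image_eqI)
      qed
    qed
  qed (use assms in auto)
  have cardT: "real (card ?T) = real N - 1" using assms by simp
  have "x (card (?A \<union> ?T)) + x (card (?A \<inter> ?T))
      \<le> joint_entropy N F Z X ?A (?A \<union> ?T) ?d + joint_entropy N F Z X ?A (?A \<inter> ?T) ?d"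
    using union inter by (rule add_mono)
  also note submod
  also note add_mono[OF rateA rateT]
  finally show ?thesis unfolding cards cardT by (simp only: mult_2)
qed

section \<open>Summation of the increments\<close>

theorem theorem1:
  fixes N K :: nat and M R :: real
  assumes "0 < N" and "0 < K"
    and "\<lceil>(real K + 1) / 2\<rceil> \<le> int N" and "N \<le> K"
    and "achievable N K M R"
  shows "real K * (real N - 1) * M + real K * R \<ge> real K * real N - 1"
proof -
  obtain F Z X where F: "0 < F" and scheme: "caching_scheme N K M R F Z X"
    and sym: "symmetric_scheme N K F Z X"
    using assms(5) unfolding achievable_def by blast
  have K: "K + 1 \<le> 2 * N" using assms(3) by (simp add: ceiling_le_iff)
  define c where "c s = cache_entropy N F Z {1..N - 1} {1..s}" for s
  define x where "x s = real N + c s - c (Suc s)" for s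
  define C where "C = (real N - 1) * M + R"
  \<comment> \<open>The indices from \<open>m\<close> to \<open>K - 1\<close> are symmetric about
    \<open>N - 1\<close>, since \<open>m + K = 2 * N - 1\<close>; the subtraction is exact as
    \<open>K + 1 \<le> 2 * N\<close>. Indices below \<open>m\<close> have no partner and are bounded
    by \<open>small\<close>.\<close>
  define m where "m = 2 * N - 1 - K"
  have m: "m \<le> K" "m + K = 2 * N - 1" "m \<le> N - 1" using K assms(4) by (auto simp: m_def)
  have small: "x s \<le> C" if "s < N" for s
    unfolding x_def c_def C_def
    by (rule cache_increment_le_rate[OF F scheme sym assms(1,4) that])
  have pair: "x s + x (K + m - Suc s) \<le> 2 * C" if s: "s \<in> {m..<K}" for s
  proof -
    \<comment> \<open>\<open>j\<close> is the distance of \<open>s\<close> from the centre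
      \<open>N - 1\<close>, and \<open>K + m - Suc s\<close> is the mirror image of
      \<open>s\<close>.\<close>
    define j where "j = (if N - 1 \<le> s then s - (N - 1) else N - 1 - s)"
    have j: "N + j \<le> K" "j < N" using s m K assms(1) by (auto simp: j_def)
    have "x (N - 1 + j) + x (N - 1 - j) \<le> 2 * C"
      unfolding C_def
      by (rule cache_increment_pair_le_rate[where x = x, OF F scheme sym assms(1) j])
        (simp add: x_def c_def)
    moreover have "(s = N - 1 + j \<and> K + m - Suc s = N - 1 - j)
        \<or> (s = N - 1 - j \<and> K + m - Suc s = N - 1 + j)"
      using s m assms(1) by (auto simp: j_def)
    ultimately show ?thesis by auto
  qed
  \<comment> \<open>Adding the sum to its reversal pairs each index with its mirror image; the
    centre is paired with itself, which is the case \<open>j = 0\<close>.\<close>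
  have "2 * (\<Sum>s = m..<K. x s) = (\<Sum>s = m..<K. x s + x (K + m - Suc s))"
    using sum.atLeastLessThan_rev[of x m K] by (simp add: sum.distrib)
  also have "\<dots> \<le> real (card {m..<K}) * (2 * C)"
    using pair by (intro sum_bounded_above)
  finally have large: "(\<Sum>s = m..<K. x s) \<le> real (K - m) * C" by simp
  have "(\<Sum>s<m. x s) \<le> real (card {..<m}) * C"
    using small m(3) assms(1) by (intro sum_bounded_above) auto
  moreover have "(\<Sum>s<K. x s) = (\<Sum>s<m. x s) + (\<Sum>s = m..<K. x s)"
    using m(1) by (simp add: lessThan_atLeast0 sum.atLeastLessThan_concat)
  ultimately have "(\<Sum>s<K. x s) \<le> real m * C + real (K - m) * C" using large by simp
  also have "\<dots> = real K * C" using m(1) by (simp add: algebra_simps)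
  finally have upper: "(\<Sum>s<K. x s) \<le> real K * C" .
  have "(\<Sum>s<K. x s) = real K * real N + (\<Sum>s<K. c s - c (Suc s))"
    by (simp add: x_def sum.distrib sum_subtractf)
  also have "\<dots> = real K * real N + c 0 - c K" by (simp add: sum_lessThan_telescope')
  finally have total: "(\<Sum>s<K. x s) = real K * real N + c 0 - c K" .
  \<comment> \<open>\<open>{1..0}\<close> is empty, so \<open>c 0\<close> is the entropy of the
    files below \<open>N\<close> alone; with \<open>c K\<close> at most \<open>N\<close>, the
    telescoped sum is at least \<open>K * N - 1\<close>.\<close>
  have "real N - 1 \<le> file_entropy N F (\<lambda>w. restrict w {1..N - 1})"
    using F assms(1) by (rule file_entropy_restrict_ge)
  also have "\<dots> \<le> c 0"
    unfolding c_def cache_entropy_def by (rule file_entropy_mono) simp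
  finally have "real N - 1 \<le> c 0" .
  moreover have "c K \<le> real N" unfolding c_def using F by (rule cache_entropy_le)
  ultimately show ?thesis using upper total by (simp add: C_def algebra_simps)
qed

end
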